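(* Let $n\geq 2$ and let $f=1^{x_{1}}0^{y_{1}}1^{x_{2}}0^{y_{2}}\cdots 1^{x_{n}}0^{y_{n}}$ with integers $x_i\geq 1$, $y_i\geq 1$ for $i=1,\ldots,n$. If $y_{1}\geq y_{n}+1$ and $x_{1}=x_{n}=1$, then $Q_{d}(f)\not\hookrightarrow Q_{d}$ for all $d\geq 2\sum_{i=2}^{n-1}x_{i}+2\sum_{i=1}^{n-1}y_{i}+y_{n}+2$ (an empty sum being $0$).
   Context: All strings are binary; $1^a$ (resp. $0^a$) denotes the string of $a$ consecutive ones (resp. zeros), and juxtaposition is concatenation. $Q_d$ is the $d$-dimensional hypercube: its vertices are the binary strings of length $d$, two being adjacent iff they differ in exactly one bit. A string $f$ is a factor of $\mu$ if $f$ appears as $|f|$ consecutive bits of $\mu$. The generalized Fibonacci cube $Q_d(f)$ is the subgraph of $Q_d$ induced by all strings of length $d$ that do not contain $f$ as a factor. A subgraph $H$ of a connected graph $G$ is an isometric subgraph, written $H\hookrightarrow G$ (and $H\not\hookrightarrow G$ otherwise), if $d_H(\mu,\nu)=d_G(\mu,\nu)$ for all $\mu,\nu\in V(H)$ (with $d_H=\infty$ for vertices in different components of $H$). *)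

theory Defs
  imports
    "Graph_Theory.Digraph_Component"
    "Graph_Theory.Shortest_Path"
    "HOL-Library.Sublist"
begin

text \<open>
  Binary strings have type \<^typ>\<open>bool list\<close>, with \<^const>\<open>True\<close> for the bit 1. An undirected graph is
  a symmetric digraph without loops or parallel arcs (the locale \<^locale>\<open>graph\<close>).
\<close>

definition hypercube :: "nat \<Rightarrow> (bool list, bool list \<times> bool list) pre_digraph" where
  "hypercube d =
    \<lparr> verts = {u. length u = d},
      arcs = {(u, v). length u = d \<and> length v = d \<and> (\<exists>!i. i < d \<and> u ! i \<noteq> v ! i)},
      tail = fst, head = snd \<rparr>"

definition fib_cube :: "nat \<Rightarrow> bool list \<Rightarrow> (bool list, bool list \<times> bool list) pre_digraph" where
  "fib_cube d f = hypercube d \<restriction> {u \<in> verts (hypercube d). \<not> sublist f u}"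

text \<open>
  Unit weights make \<open>wf_digraph.\<mu>\<close> the number of arcs of a shortest walk; it is \<open>\<infinity>\<close> when there is no
  walk. The library fact \<open>wf_digraph.\<mu>_def\<close> presupposes \<^const>\<open>wf_digraph\<close>, which is part of
  \<^const>\<open>subgraph\<close>.
\<close>

definition graph_dist :: "('a, 'b) pre_digraph \<Rightarrow> 'a \<Rightarrow> 'a \<Rightarrow> ereal" where
  "graph_dist G u v = wf_digraph.\<mu> G (\<lambda>_. 1) u v"

definition isometric_subgraph :: "('a, 'b) pre_digraph \<Rightarrow> ('a, 'b) pre_digraph \<Rightarrow> bool" where
  "isometric_subgraph H G \<longleftrightarrow>
    subgraph H G \<and> (\<forall>u \<in> verts H. \<forall>v \<in> verts H. graph_dist H u v = graph_dist G u v)"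

text \<open>The string \<open>1^(x 1) 0^(y 1) \<dots> 1^(x n) 0^(y n)\<close>, with blocks indexed from 1.\<close>

definition block_string :: "nat \<Rightarrow> (nat \<Rightarrow> nat) \<Rightarrow> (nat \<Rightarrow> nat) \<Rightarrow> bool list" where
  "block_string n x y =
    concat (map (\<lambda>i. replicate (x i) True @ replicate (y i) False) [1..<Suc n])"

text \<open>
  The subgraph condition in \<^const>\<open>isometric_subgraph\<close> always holds for \<^const>\<open>fib_cube\<close>, so
  a failure to be isometric is a failure of the distances to agree.
\<close>

lemma graph_hypercube: "graph (hypercube d)"
proof -
  let ?Q = "hypercube d"
  have ends: "tail ?Q (u, v) = u" "head ?Q (u, v) = v" for u v
    by (simp_all add: hypercube_def)
  have arc: "(u, v) \<in> arcs ?Q \<longleftrightarrow>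
      length u = d \<and> length v = d \<and> (\<exists>!i. i < d \<and> u ! i \<noteq> v ! i)" for u v
    by (simp add: hypercube_def)
  have "{u :: bool list. length u = d} = {u. set u \<subseteq> UNIV \<and> length u = d}"
    by simp
  then have fin: "finite (verts ?Q)"
    using finite_lists_length_eq[of "UNIV :: bool set" d] by (simp add: hypercube_def)
  have sub: "arcs ?Q \<subseteq> verts ?Q \<times> verts ?Q"
    unfolding hypercube_def by auto
  show ?thesis
  proof
    fix e assume "e \<in> arcs ?Q"
    then obtain u v where uv: "e = (u, v)" "(u, v) \<in> arcs ?Q"
      by (cases e) blast
    from uv sub show "tail ?Q e \<in> verts ?Q" "head ?Q e \<in> verts ?Q"
      by (auto simp only: ends)
    from uv(2) have "u \<noteq> v"
      unfolding arc by blast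
    then show "tail ?Q e \<noteq> head ?Q e"
      by (simp only: uv(1) ends not_False_eq_True)
  next
    fix e1 e2 assume "arc_to_ends ?Q e1 = arc_to_ends ?Q e2"
    then show "e1 = e2"
      by (cases e1, cases e2) (simp only: arc_to_ends_def ends)
  next
    show "finite (verts ?Q)" by (rule fin)
    show "finite (arcs ?Q)"
      using sub fin by (blast intro: finite_subset finite_cartesian_product)
  next
    have "(v, u) \<in> arcs ?Q" if "(u, v) \<in> arcs ?Q" for u v
    proof -
      have eq: "(\<exists>!i. i < d \<and> u ! i \<noteq> v ! i) \<longleftrightarrow> (\<exists>!i. i < d \<and> v ! i \<noteq> u ! i)"
        by (simp only: neq_commute)
      show ?thesis
        using that unfolding arc by (elim conjE, intro conjI) (simp_all only: eq)
    qed
    moreover have "arcs_ends ?Q = arcs ?Q"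
      by (simp add: arcs_ends_conv hypercube_def)
    ultimately show "symmetric ?Q"
      by (simp only: symmetric_def sym_def) blast
  qed
qed

lemma induced_subgraph_fib_cube: "induced_subgraph (fib_cube d f) (hypercube d)"
proof -
  interpret graph "hypercube d" by (rule graph_hypercube)
  show ?thesis
    unfolding fib_cube_def by (rule induced_induce) auto
qed

lemma subgraph_fib_cube: "subgraph (fib_cube d f) (hypercube d)"
  using induced_subgraph_fib_cube by (simp add: induced_subgraph_def)

end

theory Submission
  imports Defs
begin

text \<open>
  Write \<open>f = 1 A 1 0^k\<close> with \<open>k = y n\<close>, so that \<open>A\<close> begins with \<open>0^(k + 1)\<close> and ends with \<open>0\<close>.
  Overlap two copies of \<open>f\<close> so that the last bit of \<open>A\<close> in the first copy lies under the first bit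
  of the second copy. They disagree in exactly two adjacent positions, where the first copy reads
  \<open>01\<close> and the second \<open>10\<close>. Filling these positions with \<open>00\<close> and \<open>11\<close> gives two strings at distance
  2 whose only common neighbours in the hypercube contain \<open>f\<close>; both are themselves free of \<open>f\<close>, and
  remain so when zeros are appended to reach length \<open>d\<close>.
\<close>

section \<open>Two-step paths and a criterion against isometry\<close>

lemma arc_hypercube_iff:
  "(u, v) \<in> arcs (hypercube d) \<longleftrightarrow>
    length u = d \<and> length v = d \<and> (\<exists>!i. i < d \<and> u ! i \<noteq> v ! i)"
  by (simp add: hypercube_def)

lemma tail_hypercube [simp]: "tail (hypercube d) = fst"
  and head_hypercube [simp]: "head (hypercube d) = snd"
  by (simp_all add: hypercube_def)

lemma nth_agree_outside_two:
  assumes "i \<noteq> length P" "i \<noteq> Suc (length P)"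
  shows "(P @ a # b # S) ! i = (P @ a' # b' # S) ! i"
  using assms by (auto simp: nth_append nth_Cons split: nat.splits)

text \<open>A two-step path between strings that differ in two positions flips each of them once;
  only the order is free.\<close>

lemma common_neighbour_cases:
  assumes "(P @ False # False # S, w) \<in> arcs (hypercube d)"
    and "(w, P @ True # True # S) \<in> arcs (hypercube d)"
  shows "w = P @ False # True # S \<or> w = P @ True # False # S"
proof -
  let ?u = "P @ False # False # S" and ?v = "P @ True # True # S" and ?p = "length P"
  have len: "length w = d" "length P + length S + 2 = d"
    and u1: "\<exists>!i. i < d \<and> ?u ! i \<noteq> w ! i" and v1: "\<exists>!i. i < d \<and> w ! i \<noteq> ?v ! i"
    using assms by (auto simp: arc_hypercube_iff)
  have p: "?p < d" "Suc ?p < d" "?u ! ?p = False" "?u ! Suc ?p = False"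
    "?v ! ?p = True" "?v ! Suc ?p = True"
    using len by (auto simp: nth_append)
  \<comment> \<open>Equal bits here would give \<open>w\<close> two differences from one of the
    ends.\<close>
  have ne: "w ! ?p \<noteq> w ! Suc ?p"
    using u1 v1 p by (metis n_not_Suc_n)
  have agree: "w ! i = ?u ! i" if i: "i < d" "i \<noteq> ?p" "i \<noteq> Suc ?p" for i
  proof (rule ccontr)
    assume "w ! i \<noteq> ?u ! i"
    moreover from this have "w ! i \<noteq> ?v ! i"
      using nth_agree_outside_two[OF i(2,3)] by metis
    \<comment> \<open>One end already differs from \<open>w\<close> at \<open>?p\<close>, so for it
      \<open>i\<close> would be a second difference.\<close>
    moreover have "w ! ?p \<noteq> ?u ! ?p \<or> w ! ?p \<noteq> ?v ! ?p"
      using p by simp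
    ultimately show False
      using u1 v1 i p(1) by metis
  qed
  have "w = P @ (w ! ?p) # (w ! Suc ?p) # S"
  proof (rule nth_equalityI)
    show "length w = length (P @ (w ! ?p) # (w ! Suc ?p) # S)"
      using len by simp
  next
    fix i assume "i < length w"
    then show "w ! i = (P @ (w ! ?p) # (w ! Suc ?p) # S) ! i"
      using agree[of i] nth_agree_outside_two[of i P] len
      by (cases "i = ?p \<or> i = Suc ?p") (auto simp: nth_append)
  qed
  with ne show ?thesis
    by (cases "w ! ?p"; cases "w ! Suc ?p") simp_all
qed

lemma (in wf_digraph) awalk_cost_unit: "awalk_cost (\<lambda>_. 1 :: real) p = real (length p)"
  by (induction p) simp_all

text \<open>The distance is an infimum over walks, so a strict bound on it is met by some
  walk.\<close>

lemma graph_dist_less_imp_awalk: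
  assumes "wf_digraph G" "graph_dist G u v < ereal (real n)"
  obtains p where "pre_digraph.awalk G u p v" "length p < n"
proof -
  interpret wf_digraph G by fact
  show ?thesis
    using assms(2) that unfolding graph_dist_def \<mu>_def INF_less_iff
    by (auto simp: awalk_cost_unit)
qed

text \<open>Both possible midpoints of a two-step path between the two remaining strings are
  deleted.\<close>

lemma not_isometric_fib_cube:
  assumes free: "\<not> sublist f (P @ False # False # S)" "\<not> sublist f (P @ True # True # S)"
    and contains: "sublist f (P @ False # True # S)" "sublist f (P @ True # False # S)"
    and d: "d = length P + length S + 2"
  shows "\<not> isometric_subgraph (fib_cube d f) (hypercube d)"
proof
  let ?H = "fib_cube d f" and ?G = "hypercube d"
  let ?u = "P @ False # False # S" and ?v = "P @ True # True # S" and ?w = "P @ False # True # S"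
  assume iso: "isometric_subgraph ?H ?G"
  interpret G: graph ?G by (rule graph_hypercube)
  interpret H: wf_digraph ?H
    using subgraph_fib_cube by (simp add: subgraph_def)
  have arcs: "(?u, ?w) \<in> arcs ?G" "(?w, ?v) \<in> arcs ?G"
  proof -
    have "(?u ! i \<noteq> ?w ! i) = (i = Suc (length P))" "(?w ! i \<noteq> ?v ! i) = (i = length P)" for i
      by (auto simp: nth_append nth_Cons split: nat.splits)
    then show "(?u, ?w) \<in> arcs ?G" "(?w, ?v) \<in> arcs ?G"
      using d by (auto simp: arc_hypercube_iff)
  qed
  have verts: "?u \<in> verts ?G" "?v \<in> verts ?G"
    using d by (simp_all add: hypercube_def)
  have "G.awalk ?u [(?u, ?w), (?w, ?v)] ?v"
    using arcs verts by (simp add: G.awalk_simps)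
  from G.min_cost_le_walk_cost[OF this, of "\<lambda>_. 1"]
  have "graph_dist ?G ?u ?v \<le> 2"
    by (simp add: graph_dist_def G.awalk_cost_unit)
  moreover have "graph_dist ?H ?u ?v = graph_dist ?G ?u ?v"
    using iso verts free by (simp add: isometric_subgraph_def fib_cube_def)
  moreover have "(2 :: ereal) < ereal (real 3)"
    by simp
  ultimately have "graph_dist ?H ?u ?v < ereal (real 3)"
    by (metis order_le_less_trans)
  then obtain p where p: "H.awalk ?u p ?v" "length p < 3"
    using graph_dist_less_imp_awalk[OF H.wf_digraph_axioms] by blast
  have H_arc: "e \<in> arcs ?G" "\<not> sublist f (snd e)" if "e \<in> arcs ?H" for e
    using that by (simp_all add: fib_cube_def)
  have H_ends: "tail ?H = fst" "head ?H = snd"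
    by (simp_all add: fib_cube_def)
  consider "p = []" | e where "p = [e]" | e e' where "p = [e, e']"
    using p(2) by (cases p rule: remdups_adj.cases) auto
  then show False
  proof cases
    case 1
    with p(1) show False by (simp add: H.awalk_simps)
  next
    case 2
    with p(1) have "(?u, ?v) \<in> arcs ?G"
      using H_arc(1) by (cases e) (simp add: H.awalk_simps H_ends)
    then have "\<exists>!i. i < d \<and> ?u ! i \<noteq> ?v ! i"
      by (simp add: arc_hypercube_iff)
    moreover have "?u ! length P \<noteq> ?v ! length P" "?u ! Suc (length P) \<noteq> ?v ! Suc (length P)"
      by (simp_all add: nth_append)
    moreover have "length P < d" "Suc (length P) < d"
      using d by simp_all
    ultimately show False by (metis n_not_Suc_n)
  next
    case 3
    with p(1) obtain w where "(?u, w) \<in> arcs ?G" "(w, ?v) \<in> arcs ?G" "\<not> sublist f w"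
      using H_arc by (cases e; cases e') (fastforce simp: H.awalk_simps H_ends)
    with contains show False
      using common_neighbour_cases by blast
  qed
qed

section \<open>Freeness of the two filled strings\<close>

text \<open>
  An occurrence of \<open>1 A 1\<close> at a position \<open>s\<close> with \<open>0 < s \<le> length A\<close> starts at the bit \<open>A ! (s - 1)\<close>
  of the first copy of \<open>A\<close>; one period later this same bit is the last bit of the occurrence of \<open>A\<close>.
\<close>

lemma not_sublist_filled_with_zeros:
  assumes A: "A \<noteq> []" "\<not> hd A" "\<not> last A"
  shows "\<not> sublist (True # A @ [True]) (True # A @ A @ True # replicate m False)"
    (is "\<not> sublist _ ?u")
proof
  assume "sublist (True # A @ [True]) ?u"
  then obtain ps ss where u: "?u = ps @ True # A @ True # ss"
    by (auto simp: sublist_def)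
  define s a where "s = length ps" and "a = length A"
  have occ: "?u ! (s + j) = (True # A @ True # ss) ! j" for j
    unfolding u s_def by (simp only: nth_append_length_plus)
  have a: "0 < a" using A by (simp add: a_def)
  have "length ?u = length (ps @ True # A @ True # ss)"
    using u by (rule arg_cong)
  then have len: "s + a + 1 < 2 * a + 2 + m"
    by (simp add: s_def a_def)
  \<comment> \<open>The last 1 of the occurrence cannot lie in the zeros beyond position
    \<open>2 * a + 1\<close>.\<close>
  have "?u ! (s + (a + 1))"
    unfolding occ by (simp add: nth_append a_def)
  then have "s \<le> a"
    using len by (auto simp: nth_append nth_Cons a_def[symmetric] split: if_splits nat.splits)
  show False
  proof (cases s)
    case 0
    then have "?u = True # A @ True # ss" using u by (simp add: s_def)
    then have "A @ True # replicate m False = True # ss" by simp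
    with A show False by (cases A) auto
  next
    case (Suc t)
    have t: "t < a" using Suc \<open>s \<le> a\<close> by simp
    have "A ! t"
      using occ[of 0] t by (simp add: Suc nth_append a_def)
    moreover have "A ! t = ?u ! (s + a)"
      using t by (simp add: Suc nth_append a_def)
    moreover have "?u ! (s + a) = last A"
      unfolding occ using a by (simp add: nth_append a_def last_conv_nth nth_Cons')
    ultimately show False using A by simp
  qed
qed

text \<open>
  Here an occurrence of \<open>1 A 1\<close> at a position \<open>s\<close> with \<open>0 < s < length A\<close> would start with the bit
  \<open>A ! (s - 1) = 1\<close>, which the window covers once more in the second copy: the window then contains at
  least three ones more than \<open>A\<close>.
\<close>

lemma not_sublist_filled_with_ones:
  assumes A: "A \<noteq> []" "\<not> hd A" "\<not> last A"
  shows "\<not> sublist (True # A @ [True])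
    (True # butlast A @ True # True # tl A @ True # replicate m False)"
    (is "\<not> sublist _ ?v")
proof
  assume "sublist (True # A @ [True]) ?v"
  then obtain ps ss where v: "?v = ps @ True # A @ True # ss"
    by (auto simp: sublist_def)
  define s a where "s = length ps" and "a = length A"
  have occ: "?v ! (s + j) = (True # A @ True # ss) ! j" for j
    unfolding v s_def by (simp only: nth_append_length_plus)
  have a: "0 < a" using A by (simp add: a_def)
  have "length ?v = length (ps @ True # A @ True # ss)"
    using v by (rule arg_cong)
  then have len: "s + a + 1 < 2 * a + 2 + m"
    using a by (simp add: s_def flip: a_def)
  have vnth: "?v ! a" "?v ! (a + 1)"
    using a by (auto simp: nth_append nth_Cons' a_def)
  have "?v ! (s + (a + 1))"
    unfolding occ by (simp add: nth_append a_def)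
  then have "s \<le> a"
    using len a by (auto simp: nth_append nth_Cons' a_def[symmetric] split: if_splits)
  \<comment> \<open>For \<open>s = 0\<close> the last zero of \<open>A\<close>, for
    \<open>s = a\<close> its first zero, would fall on a filled one.\<close>
  moreover have "s \<noteq> 0"
  proof
    assume "s = 0"
    moreover have "(True # A @ True # ss) ! a = last A"
      using A a by (simp add: nth_append nth_Cons' a_def last_conv_nth)
    ultimately show False using occ[of a] vnth(1) A(3) by simp
  qed
  moreover have "s \<noteq> a"
    using occ[of 1] vnth A a by (auto simp: nth_append a_def hd_conv_nth)
  ultimately obtain t where t: "s = Suc t" "Suc t < a"
    by (metis le_neq_implies_less not0_implies_Suc)
  have At: "A ! t"
  proof -
    have "t < length (butlast A)"
      using t by (simp add: a_def)
    then show ?thesis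
      using occ[of 0] t by (simp add: nth_append nth_butlast)
  qed
  \<comment> \<open>The window starts \<open>t\<close> bits into \<open>butlast A\<close>; its
    length \<open>a + 2\<close> leaves \<open>t + 1\<close> bits of \<open>tl A\<close>.\<close>
  have window: "drop t (butlast A) @ True # True # take (Suc t) (tl A) = True # A @ [True]"
  proof -
    have "take (a + 2) (drop s ?v) = take (a + 2) (drop s (ps @ True # A @ True # ss))"
      by (simp only: v)
    then show ?thesis
      using t by (simp add: s_def a_def eval_nat_numeral)
  qed
  \<comment> \<open>\<open>butlast\<close> and \<open>tl\<close> cut off only zeros, so the window
    has the ones of \<open>drop t A\<close> and of \<open>take (t + 2) A\<close>, plus two. The one
    \<open>A ! t\<close> is counted in both.\<close>
  let ?c = "\<lambda>xs. count_list xs True"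
  have "?c (drop t A) = ?c (drop t (butlast A))"
  proof -
    have "drop t A = drop t (butlast A) @ [False]"
      using A t by (metis (full_types) a_def append_butlast_last_id drop_append length_butlast
          diff_is_0_eq' drop0 less_diff_conv less_or_eq_imp_le Suc_eq_plus1)
    then show ?thesis by simp
  qed
  moreover have "?c (take (Suc (Suc t)) A) = ?c (take (Suc t) (tl A))"
    using A by (cases A) auto
  moreover have "take (Suc (Suc t)) A = take t A @ [True, A ! Suc t]"
    using t At by (simp add: take_Suc_conv_app_nth a_def)
  moreover have "?c A = ?c (take t A) + ?c (drop t A)"
    by (metis append_take_drop_id count_list_append)
  moreover have "?c (drop t (butlast A)) + 2 + ?c (take (Suc t) (tl A)) = ?c A + 2"
    using arg_cong[OF window, of ?c] by simp
  ultimately show False by simp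
qed

section \<open>The overlap and the bound on the length\<close>

lemma not_isometric_overlap:
  assumes A: "A = replicate (Suc k) False @ C" "\<not> last A"
    and d: "d \<ge> 2 * length A + k + 2"
  shows "\<not> isometric_subgraph (fib_cube d (True # A @ True # replicate k False)) (hypercube d)"
    (is "\<not> isometric_subgraph (fib_cube d ?f) _")
proof (rule not_isometric_fib_cube)
  define r where "r = d - (2 * length A + k + 2)"
  let ?P = "True # butlast A" and ?S = "tl A @ True # replicate (k + r) False"
  have ne: "A \<noteq> []" and hd: "\<not> hd A"
    using A by simp_all
  \<comment> \<open>A filled zero is the missing last bit of the first \<open>A\<close> or the
    missing first bit of the second.\<close>
  have front: "butlast A @ False # xs = A @ xs" for xs
    using A(2) append_butlast_last_id[OF ne] by (metis (full_types) append.assoc append_Cons append_Nil)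
  have rear: "False # tl A @ xs = A @ xs" for xs
    using ne hd by (cases A) simp_all
  have sub: "sublist (True # A @ [True]) ?f"
    by (metis append_Cons append_Nil append_assoc sublist_append_rightI)
  show "\<not> sublist ?f (?P @ False # False # ?S)"
    using not_sublist_filled_with_zeros[OF ne hd A(2), of "k + r"] sublist_order.order_trans[OF sub]
    by (auto simp: front rear)
  show "\<not> sublist ?f (?P @ True # True # ?S)"
    using not_sublist_filled_with_ones[OF ne hd A(2), of "k + r"] sublist_order.order_trans[OF sub]
    by auto
  \<comment> \<open>The final \<open>0^k\<close> of the first copy is read off the second
    \<open>A\<close>, whose first of \<open>k + 1\<close> leading zeros gives way to the filled
    1.\<close>
  have "tl A = replicate k False @ C"
    using A(1) by simp
  then have "?P @ False # True # ?S = ?f @ C @ True # replicate (k + r) False"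
    by (simp add: front)
  then show "sublist ?f (?P @ False # True # ?S)"
    by (metis sublist_append_rightI)
  have "?P @ True # False # ?S = ?P @ ?f @ replicate r False"
    by (simp add: rear replicate_add)
  then show "sublist ?f (?P @ True # False # ?S)"
    by (metis sublist_appendI)
  show "d = length ?P + length ?S + 2"
    using d ne by (cases A) (auto simp: r_def)
qed

lemma block_string_split:
  assumes "n \<ge> 2"
  shows "block_string n x y = replicate (x 1) True @ replicate (y 1) False @
    concat (map (\<lambda>i. replicate (x i) True @ replicate (y i) False) [2..<n]) @
    replicate (x n) True @ replicate (y n) False"
proof -
  have "[1..<Suc n] = 1 # [2..<n] @ [n]"
    using assms by (simp add: upt_conv_Cons numeral_2_eq_2)
  then show ?thesis
    by (simp only: block_string_def) simp
qed

theorem lemma2p5: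
  fixes n d :: nat and x y :: "nat \<Rightarrow> nat"
  assumes "n \<ge> 2"
    and "\<And>i. i \<in> {1..n} \<Longrightarrow> x i \<ge> 1"
    and "\<And>i. i \<in> {1..n} \<Longrightarrow> y i \<ge> 1"
    and "y 1 \<ge> y n + 1"
    and "x 1 = 1" and "x n = 1"
    and "d \<ge> 2 * (\<Sum>i = 2..n - 1. x i) + 2 * (\<Sum>i = 1..n - 1. y i) + y n + 2"
  shows "\<not> isometric_subgraph (fib_cube d (block_string n x y)) (hypercube d)"
proof -
  let ?g = "\<lambda>i. replicate (x i) True @ replicate (y i) False"
  define M where "M = concat (map ?g [2..<n])"
  define A where "A = replicate (y 1) False @ M"
  have f: "block_string n x y = True # A @ True # replicate (y n) False"
    using block_string_split[OF assms(1)] assms(5,6) by (simp add: M_def A_def)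
  have "replicate (y 1) False = replicate (Suc (y n)) False @ replicate (y 1 - Suc (y n)) False"
    using assms(4) by (metis Suc_eq_plus1 le_add_diff_inverse replicate_add)
  then have A: "A = replicate (Suc (y n)) False @ replicate (y 1 - Suc (y n)) False @ M"
    by (simp add: A_def)
  have "\<not> last A"
  proof (cases "n = 2")
    case True
    then show ?thesis using assms(4) by (simp add: A_def M_def)
  next
    case False
    with assms(1) have "[2..<n] = [2..<n - 1] @ [n - 1]"
      by (cases n) auto
    moreover have "y (n - 1) \<ge> 1"
      using assms(1) by (intro assms(3)) auto
    ultimately show ?thesis by (simp add: A_def M_def)
  qed
  \<comment> \<open>With the \<open>y\<close>-sum split below, the bound on \<open>d\<close> becomes
    \<open>2 * length A + y n + 2\<close>.\<close>
  moreover have "length M = (\<Sum>i = 2..n - 1. x i) + (\<Sum>i = 2..n - 1. y i)"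
  proof -
    have "length M = (\<Sum>i \<in> {2..<n}. x i + y i)"
      by (simp add: M_def length_concat comp_def interv_sum_list_conv_sum_set_nat)
    moreover have "{2..<n} = {2..n - 1}"
      using assms(1) by auto
    ultimately show ?thesis by (simp add: sum.distrib)
  qed
  moreover have "(\<Sum>i = 1..n - 1. y i) = y 1 + (\<Sum>i = 2..n - 1. y i)"
    using assms(1) by (simp add: sum.atLeast_Suc_atMost numeral_2_eq_2)
  ultimately show ?thesis
    unfolding f using assms(7) by (intro not_isometric_overlap[OF A]) (auto simp: A_def)
qed

end
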